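(* Let $G$ and $H$ be connected graphs with $\mathrm{Aut}(G[H])=\mathrm{Aut}(G)[\mathrm{Aut}(H)]$. If $|V(G)|\leq |E(H)|+1$, then $D'(G[H])\leq 2$.
   Context: All graphs are finite and simple. For a graph $X$, an edge labeling $\psi:E(X)\to\{1,\dots,d\}$ is distinguishing if the only automorphism of $X$ preserving all edge labels is the identity; the distinguishing index $D'(X)$ is the least $d$ such that $X$ has a distinguishing edge labeling with $d$ labels. The lexicographic product $G[H]$ has vertex set $V(G)\times V(H)$, with $(a,x)$ adjacent to $(b,y)$ iff $ab\in E(G)$, or $a=b$ and $xy\in E(H)$. The wreath product $\mathrm{Aut}(G)[\mathrm{Aut}(H)]$ is the subgroup of $\mathrm{Aut}(G[H])$ consisting of all maps $(g,h)\mapsto(\alpha g,\beta_g h)$ with $\alpha\in\mathrm{Aut}(G)$ and $\beta_g\in\mathrm{Aut}(H)$ for each $g\in V(G)$.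
   Formalization: The formal theorem also assumes that G has at least two vertices; for G = K_1 the statement fails, since K_1[K_3] = K_3 satisfies all hypotheses but has D'(K_3) = 3. *)

theory Defs
  imports
    "Graph_Theory.Graph_Theory"
    "HOL-Combinatorics.Permutations"
    "HOL-Library.Extended_Nat"
begin

text \<open>
  A finite simple graph is a \<open>pair_graph\<close>: a finite, symmetric, loop-free digraph without
  parallel arcs. An undirected edge is a pair of opposite arcs, so edges are counted and
  labelled as two-element vertex sets.
\<close>

definition edges :: "'a pair_pre_digraph \<Rightarrow> 'a set set" where
  "edges X = {{u, v} | u v. (u, v) \<in> parcs X}"

text \<open>
  Automorphisms fix everything outside the vertex set (\<open>permutes\<close>), so that sets of
  automorphisms can be compared as sets of functions.
\<close>

definition Aut :: "'a pair_pre_digraph \<Rightarrow> ('a \<Rightarrow> 'a) set" where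
  "Aut X = {f. f permutes pverts X \<and>
     (\<forall>u \<in> pverts X. \<forall>v \<in> pverts X. (f u, f v) \<in> parcs X \<longleftrightarrow> (u, v) \<in> parcs X)}"

definition distinguishing_edge_labeling ::
    "'a pair_pre_digraph \<Rightarrow> nat \<Rightarrow> ('a set \<Rightarrow> nat) \<Rightarrow> bool" where
  "distinguishing_edge_labeling X d \<psi> \<longleftrightarrow>
     \<psi> ` edges X \<subseteq> {1..d} \<and>
     (\<forall>f \<in> Aut X. (\<forall>e \<in> edges X. \<psi> (f ` e) = \<psi> e) \<longrightarrow> f = id)"

text \<open>
  The value is \<open>\<infinity>\<close> if no distinguishing edge labeling exists, as for the complete graph on
  two vertices; a bound \<open>distinguishing_index X \<le> k\<close> therefore includes existence.
\<close>

definition distinguishing_index :: "'a pair_pre_digraph \<Rightarrow> enat" where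
  "distinguishing_index X =
     Inf (enat ` {d. 1 \<le> d \<and> (\<exists>\<psi>. distinguishing_edge_labeling X d \<psi>)})"

definition lex_product ::
    "'a pair_pre_digraph \<Rightarrow> 'b pair_pre_digraph \<Rightarrow> ('a \<times> 'b) pair_pre_digraph" where
  "lex_product G H =
     \<lparr> pverts = pverts G \<times> pverts H,
       parcs = {((a, x), (b, y)) | a x b y.
          a \<in> pverts G \<and> b \<in> pverts G \<and> x \<in> pverts H \<and> y \<in> pverts H \<and>
          ((a, b) \<in> parcs G \<or> a = b \<and> (x, y) \<in> parcs H)} \<rparr>"

text \<open>The wreath product \<open>Aut(G)[Aut(H)]\<close> in its action on the vertices of \<open>G[H]\<close>.\<close>

definition Aut_wreath ::
    "'a pair_pre_digraph \<Rightarrow> 'b pair_pre_digraph \<Rightarrow> ('a \<times> 'b \<Rightarrow> 'a \<times> 'b) set" where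
  "Aut_wreath G H =
     {f. f permutes (pverts G \<times> pverts H) \<and>
         (\<exists>\<alpha> \<in> Aut G. \<exists>\<beta>. (\<forall>g \<in> pverts G. \<beta> g \<in> Aut H) \<and>
            (\<forall>g \<in> pverts G. \<forall>h \<in> pverts H. f (g, h) = (\<alpha> g, \<beta> g h)))}"

lemma pair_graph_lex_product:
  assumes "pair_graph G" "pair_graph H"
  shows "pair_graph (lex_product G H)"
proof -
  interpret G: pair_graph G by fact
  interpret H: pair_graph H by fact
  let ?X = "lex_product G H"
  have fin: "finite (pverts ?X)"
    by (simp add: lex_product_def G.pair_finite_verts H.pair_finite_verts)
  have sub: "parcs ?X \<subseteq> pverts ?X \<times> pverts ?X"
    by (auto simp: lex_product_def)
  have finarcs: "finite (parcs ?X)"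
    by (rule finite_subset[OF sub]) (simp add: fin)
  have G_sym: "(b, a) \<in> parcs G" if "(a, b) \<in> parcs G" for a b
    using G.pair_sym_arcs that by (auto simp: symmetric_def dest: symD)
  have H_sym: "(b, a) \<in> parcs H" if "(a, b) \<in> parcs H" for a b
    using H.pair_sym_arcs that by (auto simp: symmetric_def dest: symD)
  show ?thesis
  proof
    show "symmetric (with_proj ?X)"
      unfolding symmetric_def with_proj_simps
      by (rule symI) (auto simp: lex_product_def intro: G_sym H_sym)
    show "fst e \<noteq> snd e" if "e \<in> parcs ?X" for e
      using that G.pair_no_loops H.pair_no_loops by (fastforce simp: lex_product_def)
  qed (use fin finarcs sub in auto)
qed

lemma Aut_wreath_subset_Aut: "Aut_wreath G H \<subseteq> Aut (lex_product G H)"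
proof
  fix f assume "f \<in> Aut_wreath G H"
  then obtain \<alpha> \<beta> where f: "f permutes (pverts G \<times> pverts H)"
    and \<alpha>: "\<alpha> \<in> Aut G" and \<beta>: "\<And>g. g \<in> pverts G \<Longrightarrow> \<beta> g \<in> Aut H"
    and eq: "\<And>g h. g \<in> pverts G \<Longrightarrow> h \<in> pverts H \<Longrightarrow> f (g, h) = (\<alpha> g, \<beta> g h)"
    unfolding Aut_wreath_def by blast
  have \<alpha>1: "\<alpha> a \<in> pverts G" "\<alpha> a = \<alpha> b \<longleftrightarrow> a = b" 
    if "a \<in> pverts G" for a b
    using \<alpha> that permutes_in_image[of \<alpha> "pverts G"] permutes_inj[of \<alpha> "pverts G"]
    by (auto simp: Aut_def inj_eq)
  have \<beta>1: "\<beta> a x \<in> pverts H" if "a \<in> pverts G" "x \<in> pverts H" for a x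
    using \<beta>[OF that(1)] that(2) permutes_in_image[of "\<beta> a" "pverts H"] by (auto simp: Aut_def)
  have "(f (a, x), f (b, y)) \<in> parcs (lex_product G H) \<longleftrightarrow>
        ((a, x), (b, y)) \<in> parcs (lex_product G H)"
    if "a \<in> pverts G" "b \<in> pverts G" "x \<in> pverts H" "y \<in> pverts H" for a b x y
    using that \<alpha> \<beta>[of a] \<alpha>1 \<beta>1 by (auto simp: lex_product_def eq Aut_def)
  then show "f \<in> Aut (lex_product G H)"
    using f by (auto simp: Aut_def[of "lex_product G H"]) (auto simp: lex_product_def)
qed

end

theory Submission
  imports Defs
begin

text \<open>
  Give the copies of \<open>H\<close> pairwise different numbers of edges labelled 1; this is possible because
  these numbers range over \<open>{0..|E(H)|}\<close>, which has at least \<open>|V(G)|\<close> elements. An automorphism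
  of the wreath product then maps every copy to itself. Between two adjacent copies label the
  complete bipartite graph as a half graph: for a linear order on \<open>V(H)\<close>, the edge from \<open>x\<close> to \<open>y\<close>
  gets label 1 iff \<open>x \<le> y\<close>. Vertices on the same side of a half graph have different degrees, so
  both copies are fixed pointwise. Every copy has an adjacent one since \<open>G\<close> is connected with at
  least two vertices.
\<close>

section \<open>Automorphisms acting on edges, and counting edges below a threshold\<close>

lemma image_edge_Aut:
  assumes "f \<in> Aut X" "parcs X \<subseteq> pverts X \<times> pverts X" "D \<in> edges X"
  shows "f ` D \<in> edges X"
proof -
  obtain u v where D: "D = {u, v}" "(u, v) \<in> parcs X"
    using assms(3) by (auto simp: edges_def)
  then have "(f u, f v) \<in> parcs X"
    using assms(1,2) unfolding Aut_def by blast
  then show ?thesis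
    using D(1) by (auto simp: edges_def)
qed

text \<open>Injectivity of \<open>f\<close> passes to images of sets, and an injective self-map of a
  finite set is onto.\<close>

lemma bij_betw_image_edges_Aut:
  assumes "f \<in> Aut X" "parcs X \<subseteq> pverts X \<times> pverts X" "finite (edges X)"
  shows "bij_betw ((`) f) (edges X) (edges X)"
proof -
  have "inj f"
    using assms(1) permutes_inj by (auto simp: Aut_def)
  then have inj: "inj_on ((`) f) (edges X)"
    by (simp add: inj_on_def inj_image_eq_iff)
  moreover have "(`) f ` edges X \<subseteq> edges X"
    using image_edge_Aut[OF assms(1,2)] by blast
  ultimately show ?thesis
    using endo_inj_surj[OF assms(3)] by (simp add: bij_betw_def)
qed

text \<open>Recovers the threshold of a copy of \<open>H\<close> from its number of edges labelled
  1. The case \<open>k = m\<close> is included, so m edges allow m + 1 thresholds.\<close>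

lemma card_bij_betw_atLeast0LessThan:
  fixes m k :: nat
  assumes "bij_betw e A {0..<m}" "k \<le> m"
  shows "card {x \<in> A. e x < k} = k"
proof -
  have "e ` {x \<in> A. e x < k} = e ` A \<inter> {0..<k}"
    by auto
  then have "e ` {x \<in> A. e x < k} = {0..<k}"
    using assms by (auto simp: bij_betw_def)
  moreover have "inj_on e {x \<in> A. e x < k}"
    using assms(1) by (auto simp: bij_betw_def inj_on_def)
  ultimately show ?thesis
    by (metis card_image card_atLeastLessThan diff_zero)
qed

section \<open>Rigidity of half graphs\<close>

text \<open>\<open>R\<close> is a bipartite graph between two copies of \<open>V\<close>, with
  \<open>\<beta>\<close> acting on the left and \<open>\<gamma>\<close> on the right. Since
  \<open>\<gamma>\<close> maps the neighbourhood of \<open>x\<close> bijectively onto that of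
  \<open>\<beta> x\<close>, the two degrees agree.\<close>

lemma fixed_if_distinct_degrees:
  assumes inj: "inj_on (\<lambda>x. card {y \<in> V. R x y}) V"
    and \<gamma>: "\<gamma> permutes V"
    and R: "\<And>x y. x \<in> V \<Longrightarrow> y \<in> V \<Longrightarrow> R (\<beta> x) (\<gamma> y) \<longleftrightarrow> R x y"
    and x: "x \<in> V" "\<beta> x \<in> V"
  shows "\<beta> x = x"
proof -
  have "\<gamma> ` {y \<in> V. R x y} = {y \<in> V. R (\<beta> x) y}"
  proof (intro equalityI subsetI)
    fix z assume "z \<in> {y \<in> V. R (\<beta> x) y}"
    then have z: "z \<in> V" "R (\<beta> x) z" by auto
    then obtain y where "y \<in> V" "z = \<gamma> y"
      using permutes_image[OF \<gamma>] by blast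
    then show "z \<in> \<gamma> ` {y \<in> V. R x y}"
      using z R x by auto
  qed (use R x permutes_in_image[OF \<gamma>] in auto)
  then have "card {y \<in> V. R (\<beta> x) y} = card {y \<in> V. R x y}"
    using card_image[of \<gamma> "{y \<in> V. R x y}"] permutes_inj_on[OF \<gamma>] by metis
  then show ?thesis
    using inj x by (auto dest: inj_onD)
qed

text \<open>As \<open>\<iota> u\<close> grows, up-sets shrink strictly and down-sets grow strictly.
  These sets are the neighbourhoods on the two sides, so degrees separate the vertices of either
  side.\<close>

lemma half_graph_rigid:
  fixes \<iota> :: "'b \<Rightarrow> nat"
  assumes V: "finite V" and \<iota>: "inj_on \<iota> V"
    and \<beta>: "\<beta> permutes V" and \<gamma>: "\<gamma> permutes V"
    and R: "\<And>x y. x \<in> V \<Longrightarrow> y \<in> V \<Longrightarrow> \<iota> (\<beta> x) \<le> \<iota> (\<gamma> y) \<longleftrightarrow> \<iota> x \<le> \<iota> y"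
    and x: "x \<in> V"
  shows "\<beta> x = x" "\<gamma> x = x"
proof -
  have up: "card {y \<in> V. \<iota> v \<le> \<iota> y} < card {y \<in> V. \<iota> u \<le> \<iota> y}"
    and down: "card {y \<in> V. \<iota> y \<le> \<iota> u} < card {y \<in> V. \<iota> y \<le> \<iota> v}"
    if "u \<in> V" "v \<in> V" "\<iota> u < \<iota> v" for u v
  proof -
    have "u \<in> {y \<in> V. \<iota> u \<le> \<iota> y} - {y \<in> V. \<iota> v \<le> \<iota> y}"
      "v \<in> {y \<in> V. \<iota> y \<le> \<iota> v} - {y \<in> V. \<iota> y \<le> \<iota> u}"
      using that by auto
    moreover have "{y \<in> V. \<iota> v \<le> \<iota> y} \<subseteq> {y \<in> V. \<iota> u \<le> \<iota> y}"
      "{y \<in> V. \<iota> y \<le> \<iota> u} \<subseteq> {y \<in> V. \<iota> y \<le> \<iota> v}"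
      using that by auto
    ultimately have "{y \<in> V. \<iota> v \<le> \<iota> y} \<subset> {y \<in> V. \<iota> u \<le> \<iota> y}"
      "{y \<in> V. \<iota> y \<le> \<iota> u} \<subset> {y \<in> V. \<iota> y \<le> \<iota> v}"
      by blast+
    then show "card {y \<in> V. \<iota> v \<le> \<iota> y} < card {y \<in> V. \<iota> u \<le> \<iota> y}"
      "card {y \<in> V. \<iota> y \<le> \<iota> u} < card {y \<in> V. \<iota> y \<le> \<iota> v}"
      using V by (auto intro: psubset_card_mono)
  qed
  have "inj_on (\<lambda>x. card {y \<in> V. \<iota> x \<le> \<iota> y}) V"
  proof (rule inj_onI)
    fix u v assume "u \<in> V" "v \<in> V" and "card {y \<in> V. \<iota> u \<le> \<iota> y} = card {y \<in> V. \<iota> v \<le> \<iota> y}"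
    then show "u = v"
      using inj_onD[OF \<iota>, of u v] up[of u v] up[of v u]
      by (cases "\<iota> u" "\<iota> v" rule: linorder_cases) auto
  qed
  then show "\<beta> x = x"
    by (rule fixed_if_distinct_degrees[where \<gamma> = \<gamma>])
      (use R \<gamma> x permutes_in_image[OF \<beta>] in auto)
  have "inj_on (\<lambda>x. card {y \<in> V. \<iota> y \<le> \<iota> x}) V"
  proof (rule inj_onI)
    fix u v assume "u \<in> V" "v \<in> V" and "card {y \<in> V. \<iota> y \<le> \<iota> u} = card {y \<in> V. \<iota> y \<le> \<iota> v}"
    then show "u = v"
      using inj_onD[OF \<iota>, of u v] down[of u v] down[of v u]
      by (cases "\<iota> u" "\<iota> v" rule: linorder_cases) auto
  qed
  \<comment> \<open>Here the half graph is read from its right side, so \<open>\<beta>\<close> and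
    \<open>\<gamma>\<close> exchange roles.\<close>
  then show "\<gamma> x = x"
    by (rule fixed_if_distinct_degrees[where \<gamma> = \<beta>])
      (use R \<beta> x permutes_in_image[OF \<gamma>] in auto)
qed

text \<open>A connected symmetric digraph is strongly connected, so a second vertex is reachable
  from \<open>a\<close>; the first arc of a walk to it gives the neighbour.\<close>

lemma connected_has_neighbour:
  assumes "pair_graph G" "Digraph_Component.connected (with_proj G)"
    and "card (pverts G) \<ge> 2" "a \<in> pverts G"
  obtains b where "b \<in> pverts G" "(a, b) \<in> parcs G"
proof -
  interpret G: pair_graph G by fact
  have "\<not> pverts G \<subseteq> {a}"
    using assms(3) card_mono[of "{a}" "pverts G"] by auto
  then obtain c where c: "c \<in> pverts G" "c \<noteq> a" by blast
  have "strongly_connected (with_proj G)"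
    using G.symmetric_connected_imp_strongly_connected[OF G.sym_arcs assms(2)] .
  then have "a \<rightarrow>\<^sup>*\<^bsub>with_proj G\<^esub> c"
    using assms(4) c by (auto simp: strongly_connected_def)
  then have "\<exists>b. (a, b) \<in> parcs G"
    using c(2) by (cases rule: G.converse_reachable_cases) auto
  then show ?thesis
    using that G.in_arcsD2 by blast
qed

section \<open>The edges labelled 1\<close>

text \<open>With \<open>e\<close> enumerating the edges of \<open>H\<close> from 0, the copy over
  \<open>g\<close> has \<open>\<phi> g\<close> edges labelled 1. As edges are unordered,
  \<open>\<phi>\<close> also decides which copy is the left side of a half graph. The second set may
  contain pairs that are not edges, but labels matter only on edges.\<close>

definition first_label ::
    "'b pair_pre_digraph \<Rightarrow> ('a \<Rightarrow> nat) \<Rightarrow> ('b set \<Rightarrow> nat) \<Rightarrow> ('b \<Rightarrow> nat) \<Rightarrow> ('a \<times> 'b) set set" where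
  "first_label H \<phi> e \<iota> =
     {Pair g ` D | g D. D \<in> edges H \<and> e D < \<phi> g} \<union>
     {{(a, x), (b, y)} | a x b y. \<phi> a < \<phi> b \<and> \<iota> x \<le> \<iota> y}"

lemma first_label_inside:
  assumes "D \<in> edges H"
  shows "Pair g ` D \<in> first_label H \<phi> e \<iota> \<longleftrightarrow> e D < \<phi> g"
proof -
  \<comment> \<open>Nonemptiness lets the first projection recover \<open>g\<close>; the second
    recovers \<open>D\<close>.\<close>
  have "D \<noteq> {}"
    using assms by (auto simp: edges_def)
  have "h = g \<and> E = D" if "Pair g ` D = Pair h ` E" for h E
  proof -
    have "fst ` Pair g ` D = fst ` Pair h ` E" "snd ` Pair g ` D = snd ` Pair h ` E"
      using that by auto
    then show ?thesis
      using \<open>D \<noteq> {}\<close> by (auto simp: image_image split: if_splits)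
  qed
  moreover have "a = b" if "Pair g ` D = {(a, x), (b, y)}" for a x b y
  proof -
    have "(a, x) \<in> Pair g ` D" "(b, y) \<in> Pair g ` D"
      unfolding that by auto
    then show ?thesis
      by auto
  qed
  ultimately show ?thesis
    using assms unfolding first_label_def by blast
qed

text \<open>The ends lie in different copies, which excludes the first set; the strict inequality
  excludes matching the unordered pair with its ends swapped.\<close>

lemma first_label_between:
  assumes "\<phi> a < \<phi> b"
  shows "{(a, x), (b, y)} \<in> first_label H \<phi> e \<iota> \<longleftrightarrow> \<iota> x \<le> \<iota> y"
proof -
  have "{(a, x), (b, y)} \<noteq> Pair g ` D" for g and D :: "'b set"
  proof
    assume "{(a, x), (b, y)} = Pair g ` D"
    then have "(a, x) \<in> Pair g ` D" "(b, y) \<in> Pair g ` D"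
      by (metis insertCI)+
    then show False
      using assms by auto
  qed
  then show ?thesis
    using assms unfolding first_label_def by (auto simp: doubleton_eq_iff)
qed

theorem theorem3p6:
  fixes G :: "'a pair_pre_digraph" and H :: "'b pair_pre_digraph"
  assumes "pair_graph G" and "pair_graph H"
    and "Digraph_Component.connected (with_proj G)"
    and "Digraph_Component.connected (with_proj H)"
    and "card (pverts G) \<ge> 2"
    and "Aut (lex_product G H) = Aut_wreath G H"
    and "card (pverts G) \<le> card (edges H) + 1"
  shows "distinguishing_index (lex_product G H) \<le> 2"
proof -
  interpret G: pair_graph G by fact
  interpret H: pair_graph H by fact
  have arcsG: "parcs G \<subseteq> pverts G \<times> pverts G" and arcsH: "parcs H \<subseteq> pverts H \<times> pverts H"
    using G.in_arcsD1 G.in_arcsD2 H.in_arcsD1 H.in_arcsD2 by auto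
  have "edges H \<subseteq> Pow (pverts H)"
    using arcsH by (auto simp: edges_def)
  then have fin: "finite (edges H)"
    using finite_subset by (fastforce simp: H.pair_finite_verts)
  obtain \<phi> where \<phi>: "bij_betw \<phi> (pverts G) {0..<card (pverts G)}"
    using ex_bij_betw_finite_nat[OF G.pair_finite_verts] by blast
  obtain \<iota> where "bij_betw \<iota> (pverts H) {0..<card (pverts H)}"
    using ex_bij_betw_finite_nat[OF H.pair_finite_verts] by blast
  then have \<iota>: "inj_on \<iota> (pverts H)"
    by (simp add: bij_betw_def)
  obtain e where e: "bij_betw e (edges H) {0..<card (edges H)}"
    using ex_bij_betw_finite_nat[OF fin] by blast
  \<comment> \<open>\<open>\<phi>\<close> starts at 0, which is why the bound with
    \<open>+ 1\<close> suffices.\<close>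
  have \<phi>_le: "\<phi> g \<le> card (edges H)" if "g \<in> pverts G" for g
    using bij_betwE[OF \<phi>] that assms(7) by fastforce
  have \<phi>_eq: "g = h" if "g \<in> pverts G" "h \<in> pverts G" "\<phi> g = \<phi> h" for g h
    using \<phi> that by (auto simp: bij_betw_def dest: inj_onD)
  define S where "S = first_label H \<phi> e \<iota>"
  define \<psi> :: "('a \<times> 'b) set \<Rightarrow> nat" where "\<psi> E = (if E \<in> S then 1 else 2)" for E
  have "f = id" if f: "f \<in> Aut (lex_product G H)"
    and pres: "\<forall>E \<in> edges (lex_product G H). \<psi> (f ` E) = \<psi> E" for f
  proof -
    have S: "f ` E \<in> S \<longleftrightarrow> E \<in> S" if "E \<in> edges (lex_product G H)" for E
      using pres that by (fastforce simp: \<psi>_def split: if_splits)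
    have "f \<in> Aut_wreath G H"
      using f assms(6) by simp
    then obtain \<alpha> \<beta> where perm: "f permutes (pverts G \<times> pverts H)" and \<alpha>: "\<alpha> \<in> Aut G"
      and \<beta>: "\<And>g. g \<in> pverts G \<Longrightarrow> \<beta> g \<in> Aut H"
      and f_eq: "\<And>g h. g \<in> pverts G \<Longrightarrow> h \<in> pverts H \<Longrightarrow> f (g, h) = (\<alpha> g, \<beta> g h)"
      unfolding Aut_wreath_def by blast
    have \<beta>_perm: "\<beta> g permutes pverts H" if "g \<in> pverts G" for g
      using \<beta>[OF that] by (simp add: Aut_def)
    have \<alpha>_id: "\<alpha> g = g" if g: "g \<in> pverts G" for g
    proof -
      have \<alpha>g: "\<alpha> g \<in> pverts G"
        using \<alpha> g permutes_in_image[of \<alpha> "pverts G"] by (auto simp: Aut_def)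
      have bij: "bij_betw ((`) (\<beta> g)) (edges H) (edges H)"
        using bij_betw_image_edges_Aut[OF \<beta>[OF g] arcsH fin] .
      \<comment> \<open>\<open>f\<close> carries the copy over \<open>g\<close> to the copy over
        \<open>\<alpha> g\<close> through \<open>\<beta> g\<close>, and keeps label 1. Counting such
        edges in both copies then gives equal thresholds.\<close>
      have less: "e (\<beta> g ` D) < \<phi> (\<alpha> g) \<longleftrightarrow> e D < \<phi> g" if D: "D \<in> edges H" for D
      proof -
        have "D \<subseteq> pverts H"
          using D arcsH by (auto simp: edges_def)
        then have "f ` Pair g ` D = Pair (\<alpha> g) ` (\<beta> g ` D)"
          using f_eq[OF g] by (force simp: image_image)
        moreover have "Pair g ` D \<in> edges (lex_product G H)"
          using D arcsH g by (fastforce simp: edges_def lex_product_def)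
        ultimately show ?thesis
          using S first_label_inside D bij_betwE[OF bij] unfolding S_def by metis
      qed
      have "(`) (\<beta> g) ` {D \<in> edges H. e D < \<phi> g} = {D \<in> edges H. e D < \<phi> (\<alpha> g)}"
        using Compr_image_eq[of "(`) (\<beta> g)" "edges H" "\<lambda>D. e D < \<phi> (\<alpha> g)"]
          bij_betw_imp_surj_on[OF bij] less by (simp cong: conj_cong)
      then have "bij_betw ((`) (\<beta> g)) {D \<in> edges H. e D < \<phi> g} {D \<in> edges H. e D < \<phi> (\<alpha> g)}"
        by (intro bij_betw_subset[OF bij]) auto
      then have "card {D \<in> edges H. e D < \<phi> g} = card {D \<in> edges H. e D < \<phi> (\<alpha> g)}"
        by (rule bij_betw_same_card)
      then have "\<phi> (\<alpha> g) = \<phi> g"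
        using card_bij_betw_atLeast0LessThan[OF e] \<phi>_le g \<alpha>g by simp
      then show ?thesis
        using \<phi>_eq g \<alpha>g by blast
    qed
    \<comment> \<open>With \<open>\<alpha>\<close> trivial on \<open>pverts G\<close>,
      \<open>f\<close> preserves both sides of the half graph between the copies over
      \<open>a\<close> and \<open>b\<close>.\<close>
    have \<beta>_id: "\<beta> a x = x \<and> \<beta> b x = x"
      if ab: "a \<in> pverts G" "b \<in> pverts G" "(a, b) \<in> parcs G" "\<phi> a < \<phi> b" and x: "x \<in> pverts H"
      for a b x
    proof -
      have "\<iota> (\<beta> a x) \<le> \<iota> (\<beta> b y) \<longleftrightarrow> \<iota> x \<le> \<iota> y" if "x \<in> pverts H" "y \<in> pverts H" for x y
      proof -
        have "{(a, x), (b, y)} \<in> edges (lex_product G H)"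
          using ab that by (auto simp: edges_def lex_product_def)
        moreover have "f ` {(a, x), (b, y)} = {(a, \<beta> a x), (b, \<beta> b y)}"
          using f_eq \<alpha>_id ab that by simp
        ultimately show ?thesis
          using S first_label_between[of \<phi>, OF ab(4)] unfolding S_def by metis
      qed
      then show ?thesis
        using half_graph_rigid[OF H.pair_finite_verts \<iota> \<beta>_perm \<beta>_perm] ab x by metis
    qed
    have "f (g, h) = (g, h)" if g: "g \<in> pverts G" and h: "h \<in> pverts H" for g h
    proof -
      obtain b where b: "b \<in> pverts G" "(g, b) \<in> parcs G"
        using connected_has_neighbour[OF assms(1,3,5) g] .
      then have "(b, g) \<in> parcs G"
        using G.pair_sym_arcs by (auto simp: symmetric_def dest: symD)
      moreover have "g \<noteq> b"
        using G.pair_no_loops b(2) by fastforce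
      \<comment> \<open>The copy over \<open>g\<close> may be either side of the half graph;
        \<open>\<beta>_id\<close> fixes both.\<close>
      then have "\<phi> g < \<phi> b \<or> \<phi> b < \<phi> g"
        using \<phi>_eq g b(1) by (meson linorder_neqE_nat)
      ultimately have "\<beta> g h = h"
        using \<beta>_id g b h by blast
      then show ?thesis
        using f_eq \<alpha>_id g h by simp
    qed
    then show "f = id"
      using permutes_not_in[OF perm] by fastforce
  qed
  then have "distinguishing_edge_labeling (lex_product G H) 2 \<psi>"
    unfolding distinguishing_edge_labeling_def by (auto simp: \<psi>_def)
  then have "distinguishing_index (lex_product G H) \<le> enat 2"
    unfolding distinguishing_index_def by (intro Inf_lower) auto
  then show ?thesis
    by (simp add: numeral_eq_enat)
qed

end
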